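(* Let $\ell\geq 2$ and $n_1,\ldots,n_\ell\geq 2$ be integers. Then $\mathcal{R}(K_{n_1,\ldots,n_\ell})\cong AFR(n_1,\ldots,n_\ell)$.
   Context: All graphs are finite, simple and undirected; $N(v)$ denotes the open neighbourhood of $v$. A set $S\subseteq V(G)$ is a dominating set if every vertex of $G$ is in $S$ or adjacent to a vertex of $S$; it is a minimal dominating set if no proper subset of $S$ is a dominating set. The reconfiguration graph $\mathcal{R}(G)$ has as vertex set the collection of all minimal dominating sets of $G$, and two minimal dominating sets $M_1,M_2$ are adjacent iff there is a vertex $v$ with either ($M_2\setminus M_1=\{v\}$ and $M_1\setminus M_2\subseteq N(v)$) or ($M_1\setminus M_2=\{v\}$ and $M_2\setminus M_1\subseteq N(v)$). $K_{n_1,\ldots,n_\ell}$ is the complete multipartite graph with parts of sizes $n_1,\ldots,n_\ell$. The altered folded rook's graph $AFR(n_1,\ldots,n_\ell)$: let $n=n_1+\cdots+n_\ell$ and partition $\{1,\ldots,n\}$ into consecutive blocks $N_1,\ldots,N_\ell$, where $N_k=\{n_1+\cdots+n_{k-1}+1,\ldots,n_1+\cdots+n_k\}$. Start from the $n$ by $n$ folded rook's graph, whose vertices are the pairs $(i,j)$ with $1\le j\le i\le n$ and where $(i,j)\sim(k,l)$ (distinct) iff $\{i,j\}\cap\{k,l\}\neq\emptyset$. Then: for each $k$, contract all vertices $(i,j)$ with $i,j\in N_k$ into a single vertex, labelled $k$ (adjacent to every vertex outside that was adjacent to one of the contracted vertices); and for each $k\neq m$, delete all edges between two vertices both of which lie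 in $N_k\times N_m$. Equivalently, $AFR(n_1,\ldots,n_\ell)$ has vertices $1,\ldots,\ell$ together with all pairs $(i,j)$, $j<i$, with $i,j$ in different blocks; vertex $k$ is adjacent to $(i,j)$ iff $\{i,j\}\cap N_k\neq\emptyset$; the vertices $1,\ldots,\ell$ are pairwise non-adjacent; and distinct pairs $(i,j),(i',j')$ are adjacent iff $\{i,j\}\cap\{i',j'\}\neq\emptyset$ and they do not both lie in $N_k\times N_m$ for the same $k\neq m$. *)

theory Defs
  imports
    "Graph_Theory.Digraph_Isomorphism"
    "Graph_Theory.Pair_Digraph"
begin

text \<open>
  A finite simple undirected graph is a \<^locale>\<open>pair_graph\<close>: an edge between \<open>u\<close> and \<open>v\<close> is the
  pair of arcs \<open>(u, v)\<close> and \<open>(v, u)\<close>.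
\<close>

lemma pair_graphI:
  assumes "finite (pverts G)"
    and "\<And>u v. (u, v) \<in> parcs G \<Longrightarrow> u \<in> pverts G \<and> u \<noteq> v \<and> (v, u) \<in> parcs G"
  shows "pair_graph G"
proof
  have sub: "parcs G \<subseteq> pverts G \<times> pverts G"
    using assms(2) by auto
  show "finite (parcs G)"
    using sub finite_cartesian_product[OF assms(1) assms(1)] by (rule finite_subset)
  show "symmetric (with_proj G)"
    using assms(2) by (auto simp: symmetric_def intro: symI)
  show "fst e \<in> pverts G" if "e \<in> parcs G" for e
    using that sub by auto
  show "snd e \<in> pverts G" if "e \<in> parcs G" for e
    using that sub by auto
  show "fst e \<noteq> snd e" if "e \<in> parcs G" for e
    using that assms(2)[of "fst e" "snd e"] by simp
qed (rule assms(1))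

text \<open>
  For graphs without parallel arcs, \<^const>\<open>digraph_iso\<close> is the usual notion of isomorphism.
\<close>

lemma digraph_iso_with_proj_iff:
  assumes G: "pair_wf_digraph G" and H: "pair_wf_digraph H"
  shows "digraph_iso (with_proj G) (with_proj H) \<longleftrightarrow>
    (\<exists>f. bij_betw f (pverts G) (pverts H) \<and>
      (\<forall>u\<in>pverts G. \<forall>v\<in>pverts G. (u, v) \<in> parcs G \<longleftrightarrow> (f u, f v) \<in> parcs H))"
    (is "?L \<longleftrightarrow> ?R")
proof
  assume ?L
  then obtain h where h: "pre_digraph.digraph_isomorphism (with_proj G) h"
    and eq: "with_proj H = app_iso h (with_proj G)"
    by (auto simp: digraph_iso_def)
  let ?f = "iso_verts h"
  have inj: "inj_on ?f (pverts G)"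
    using h by (simp add: pre_digraph.digraph_isomorphism_def)
  have verts: "pverts H = ?f ` pverts G"
    using arg_cong[OF eq, of verts] by simp
  have arcs: "parcs H = iso_arcs h ` parcs G"
    using arg_cong[OF eq, of arcs] by simp
  have tl: "iso_tail h = fst" and hd: "iso_head h = snd"
    using arg_cong[OF eq, of tail] arg_cong[OF eq, of head] by simp_all
  have arc: "iso_arcs h (u, v) = (?f u, ?f v)" if "(u, v) \<in> parcs G" for u v
    using h that tl hd by (auto simp: pre_digraph.digraph_isomorphism_def prod_eq_iff)
  have iff: "(u, v) \<in> parcs G \<longleftrightarrow> (?f u, ?f v) \<in> parcs H"
    if "u \<in> pverts G" "v \<in> pverts G" for u v
  proof
    assume "(u, v) \<in> parcs G"
    then show "(?f u, ?f v) \<in> parcs H"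
      using arcs arc by force
  next
    assume "(?f u, ?f v) \<in> parcs H"
    then obtain a b where ab: "(a, b) \<in> parcs G" "(?f u, ?f v) = iso_arcs h (a, b)"
      using arcs by auto
    then have "?f u = ?f a" "?f v = ?f b"
      using arc by auto
    moreover have "a \<in> pverts G" "b \<in> pverts G"
      using pair_wf_digraph.wellformed'[OF G ab(1)] by auto
    ultimately show "(u, v) \<in> parcs G"
      using inj that ab(1) by (auto dest: inj_onD)
  qed
  show ?R
    using inj verts iff by (intro exI[of _ ?f]) (auto simp: bij_betw_def)
next
  assume ?R
  then obtain f where f: "bij_betw f (pverts G) (pverts H)"
    and iff: "\<And>u v. u \<in> pverts G \<Longrightarrow> v \<in> pverts G \<Longrightarrow> (u, v) \<in> parcs G \<longleftrightarrow> (f u, f v) \<in> parcs H"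
    by blast
  let ?h = "\<lparr>iso_verts = f, iso_arcs = map_prod f f, iso_head = snd, iso_tail = fst\<rparr>"
  have sub: "parcs G \<subseteq> pverts G \<times> pverts G"
    using pair_wf_digraph.wellformed'[OF G] by auto
  have inj: "inj_on f (pverts G)"
    using f by (simp add: bij_betw_def)
  have "inj_on (map_prod f f) (parcs G)"
    using map_prod_inj_on[OF inj inj] sub by (rule inj_on_subset)
  then have iso: "pre_digraph.digraph_isomorphism (with_proj G) ?h"
    using inj G by (simp add: pre_digraph.digraph_isomorphism_def wf_digraph_wp_iff)
  have "parcs H = map_prod f f ` parcs G"
  proof
    show "map_prod f f ` parcs G \<subseteq> parcs H"
      using sub iff by auto
    show "parcs H \<subseteq> map_prod f f ` parcs G"
    proof
      fix e assume e: "e \<in> parcs H"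
      obtain x y where xy: "e = (x, y)" by (cases e)
      then have "x \<in> f ` pverts G" "y \<in> f ` pverts G"
        using pair_wf_digraph.wellformed'[OF H] e f by (auto simp: bij_betw_def)
      then obtain u v where "u \<in> pverts G" "v \<in> pverts G" "x = f u" "y = f v" by auto
      then show "e \<in> map_prod f f ` parcs G"
        using iff e xy by force
    qed
  qed
  then have "with_proj H = app_iso ?h (with_proj G)"
    using f by (simp add: with_proj_def app_iso_def bij_betw_def)
  then show ?L
    using iso by (auto simp: digraph_iso_def)
qed


section \<open>Minimal dominating sets and their reconfiguration graph\<close>

definition open_nbhd :: "'a pair_pre_digraph \<Rightarrow> 'a \<Rightarrow> 'a set" where
  "open_nbhd G v = {u. (v, u) \<in> parcs G}"

definition dominating_set :: "'a pair_pre_digraph \<Rightarrow> 'a set \<Rightarrow> bool" where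
  "dominating_set G S \<longleftrightarrow>
    S \<subseteq> pverts G \<and> (\<forall>v\<in>pverts G. v \<in> S \<or> (\<exists>u\<in>S. (v, u) \<in> parcs G))"

definition minimal_dominating_set :: "'a pair_pre_digraph \<Rightarrow> 'a set \<Rightarrow> bool" where
  "minimal_dominating_set G S \<longleftrightarrow> dominating_set G S \<and> (\<forall>T. T \<subset> S \<longrightarrow> \<not> dominating_set G T)"

definition reconf_adj :: "'a pair_pre_digraph \<Rightarrow> 'a set \<Rightarrow> 'a set \<Rightarrow> bool" where
  "reconf_adj G M1 M2 \<longleftrightarrow>
    (\<exists>v\<in>pverts G. (M2 - M1 = {v} \<and> M1 - M2 \<subseteq> open_nbhd G v) \<or>
                  (M1 - M2 = {v} \<and> M2 - M1 \<subseteq> open_nbhd G v))"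

definition reconf_graph :: "'a pair_pre_digraph \<Rightarrow> 'a set pair_pre_digraph" where
  "reconf_graph G =
    \<lparr>pverts = {M. minimal_dominating_set G M},
     parcs = {(M1, M2). minimal_dominating_set G M1 \<and> minimal_dominating_set G M2 \<and>
       reconf_adj G M1 M2}\<rparr>"

lemma pair_graph_reconf_graph:
  assumes "finite (pverts G)"
  shows "pair_graph (reconf_graph G)"
proof (rule pair_graphI)
  have "pverts (reconf_graph G) \<subseteq> Pow (pverts G)"
    by (auto simp: reconf_graph_def minimal_dominating_set_def dominating_set_def)
  then show "finite (pverts (reconf_graph G))"
    using assms by (auto intro: finite_subset)
qed (auto simp: reconf_graph_def reconf_adj_def)


section \<open>Complete multipartite graphs\<close>

text \<open>
  The vertex \<open>(k, a)\<close> is the \<open>a\<close>-th vertex of the \<open>k\<close>-th part. Only the values of \<open>n\<close> on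
  \<open>{1..l}\<close> matter, here and below.
\<close>

definition complete_multipartite :: "nat \<Rightarrow> (nat \<Rightarrow> nat) \<Rightarrow> (nat \<times> nat) pair_pre_digraph" where
  "complete_multipartite l n =
    (let V = (SIGMA k:{1..l}. {1..n k})
     in \<lparr>pverts = V, parcs = {(u, v). u \<in> V \<and> v \<in> V \<and> fst u \<noteq> fst v}\<rparr>)"

lemma pair_graph_complete_multipartite: "pair_graph (complete_multipartite l n)"
  by (rule pair_graphI) (auto simp: complete_multipartite_def Let_def)


section \<open>The altered folded rook's graph\<close>

definition block :: "(nat \<Rightarrow> nat) \<Rightarrow> nat \<Rightarrow> nat set" where
  "block n k = {(\<Sum>i=1..<k. n i) + 1..(\<Sum>i=1..k. n i)}"

definition folded_rook :: "nat \<Rightarrow> (nat \<times> nat) pair_pre_digraph" where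
  "folded_rook N =
    (let V = {(i, j). 1 \<le> j \<and> j \<le> i \<and> i \<le> N}
     in \<lparr>pverts = V,
         parcs = {((i, j), (i', j')). (i, j) \<in> V \<and> (i', j') \<in> V \<and> (i, j) \<noteq> (i', j') \<and>
           {i, j} \<inter> {i', j'} \<noteq> {}}\<rparr>)"

text \<open>
  Identifies the vertices in each fibre of \<open>q\<close>, dropping the resulting loops and parallel edges.
\<close>

definition contract :: "('a \<Rightarrow> 'b) \<Rightarrow> 'a pair_pre_digraph \<Rightarrow> 'b pair_pre_digraph" where
  "contract q G =
    \<lparr>pverts = q ` pverts G,
     parcs = {(q u, q v) | u v. (u, v) \<in> parcs G \<and> q u \<noteq> q v}\<rparr>"

datatype afr_vertex = Contracted nat | Cell nat nat

definition afr_label :: "nat \<Rightarrow> (nat \<Rightarrow> nat) \<Rightarrow> nat \<times> nat \<Rightarrow> afr_vertex" where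
  "afr_label l n = (\<lambda>(i, j).
    if \<exists>k\<in>{1..l}. i \<in> block n k \<and> j \<in> block n k
    then Contracted (THE k. k \<in> {1..l} \<and> i \<in> block n k \<and> j \<in> block n k)
    else Cell i j)"

definition AFR :: "nat \<Rightarrow> (nat \<Rightarrow> nat) \<Rightarrow> afr_vertex pair_pre_digraph" where
  "AFR l n =
    (let C = contract (afr_label l n) (folded_rook (\<Sum>i=1..l. n i))
     in \<lparr>pverts = pverts C,
         parcs = parcs C -
           {(Cell i j, Cell i' j') | i j i' j'. \<exists>k\<in>{1..l}. \<exists>m\<in>{1..l}. k \<noteq> m \<and>
             (i, j) \<in> block n k \<times> block n m \<and> (i', j') \<in> block n k \<times> block n m}\<rparr>)"

lemma block_disjoint:
  assumes "x \<in> block n k" "x \<in> block n m" "1 \<le> k" "1 \<le> m"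
  shows "k = m"
proof -
  have False if "x \<in> block n k" "x \<in> block n m" "k < m" for k m
  proof -
    have "(\<Sum>i=1..k. n i) \<le> (\<Sum>i=1..<m. n i)"
      using that(3) by (intro sum_mono2) auto
    then show False
      using that by (auto simp: block_def)
  qed
  then show ?thesis
    using assms by (meson nat_neq_iff)
qed

lemma Union_block: "(\<Union>k\<in>{1..l}. block n k) = {1..(\<Sum>i=1..l. n i)}"
proof (induction l)
  case (Suc l)
  have "(\<Sum>i=1..<Suc l. n i) = (\<Sum>i=1..l. n i)"
    by (simp add: atLeastLessThanSuc_atLeastAtMost)
  then have "block n (Suc l) = {(\<Sum>i=1..l. n i) + 1..(\<Sum>i=1..l. n i) + n (Suc l)}"
    by (simp add: block_def)
  moreover have "(\<Union>k\<in>{1..Suc l}. block n k) = (\<Union>k\<in>{1..l}. block n k) \<union> block n (Suc l)"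
    by (auto simp: atLeastAtMostSuc_conv)
  ultimately show ?case
    using Suc.IH by auto
qed simp

lemma afr_label_Contracted:
  assumes "k \<in> {1..l}" "i \<in> block n k" "j \<in> block n k"
  shows "afr_label l n (i, j) = Contracted k"
proof -
  have "(THE k. k \<in> {1..l} \<and> i \<in> block n k \<and> j \<in> block n k) = k"
    using assms block_disjoint by (intro the_equality) auto
  then show ?thesis
    using assms by (auto simp: afr_label_def)
qed

text \<open>
  The explicit description of the altered folded rook's graph obtained from the construction.
\<close>

definition afr_cells :: "nat \<Rightarrow> (nat \<Rightarrow> nat) \<Rightarrow> (nat \<times> nat) set" where
  "afr_cells l n =
    {(i, j). j < i \<and> (\<exists>k\<in>{1..l}. \<exists>m\<in>{1..l}. k \<noteq> m \<and> i \<in> block n k \<and> j \<in> block n m)}"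

definition afr_adj :: "nat \<Rightarrow> (nat \<Rightarrow> nat) \<Rightarrow> afr_vertex \<Rightarrow> afr_vertex \<Rightarrow> bool" where
  "afr_adj l n u v = (case (u, v) of
      (Contracted k, Contracted m) \<Rightarrow> False
    | (Contracted k, Cell i j) \<Rightarrow> {i, j} \<inter> block n k \<noteq> {}
    | (Cell i j, Contracted k) \<Rightarrow> {i, j} \<inter> block n k \<noteq> {}
    | (Cell i j, Cell i' j') \<Rightarrow> (i, j) \<noteq> (i', j') \<and> {i, j} \<inter> {i', j'} \<noteq> {} \<and>
        \<not> (\<exists>k\<in>{1..l}. \<exists>m\<in>{1..l}. k \<noteq> m \<and>
          (i, j) \<in> block n k \<times> block n m \<and> (i', j') \<in> block n k \<times> block n m))"

lemma afr_adj_irrefl: "\<not> afr_adj l n u u"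
  by (cases u) (auto simp: afr_adj_def)

lemma afr_adj_sym: "afr_adj l n u v \<Longrightarrow> afr_adj l n v u"
  by (cases u; cases v) (simp_all add: afr_adj_def, blast)

lemma afr_label_cell: "(i, j) \<in> afr_cells l n \<Longrightarrow> afr_label l n (i, j) = Cell i j"
proof -
  assume "(i, j) \<in> afr_cells l n"
  then obtain k m where "k \<in> {1..l}" "m \<in> {1..l}" "k \<noteq> m" "i \<in> block n k" "j \<in> block n m"
    by (auto simp: afr_cells_def)
  then have "\<not> (\<exists>k\<in>{1..l}. i \<in> block n k \<and> j \<in> block n k)"
    using block_disjoint by (metis atLeastAtMost_iff)
  then show ?thesis by (simp add: afr_label_def)
qed

lemma folded_rook_cases:
  assumes "(i, j) \<in> pverts (folded_rook (\<Sum>i=1..l. n i))"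
  obtains (contracted) k where "k \<in> {1..l}" "i \<in> block n k" "j \<in> block n k"
      "afr_label l n (i, j) = Contracted k"
    | (cell) "(i, j) \<in> afr_cells l n" "afr_label l n (i, j) = Cell i j"
proof -
  have ij: "i \<in> {1..(\<Sum>i=1..l. n i)}" "j \<in> {1..(\<Sum>i=1..l. n i)}" "j \<le> i"
    using assms by (auto simp: folded_rook_def)
  then obtain k m where km: "k \<in> {1..l}" "i \<in> block n k" "m \<in> {1..l}" "j \<in> block n m"
    unfolding Union_block[symmetric] by blast
  show thesis
  proof (cases "k = m")
    case True
    then show thesis using km afr_label_Contracted contracted by blast
  next
    case False
    then have "i \<noteq> j" using km block_disjoint by auto
    then have "j < i" using ij(3) by simp
    then have "(i, j) \<in> afr_cells l n"
      using km False unfolding afr_cells_def by blast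
    then show thesis using afr_label_cell cell by blast
  qed
qed

lemma block_subset: "k \<in> {1..l} \<Longrightarrow> i \<in> block n k \<Longrightarrow> 1 \<le> i \<and> i \<le> (\<Sum>i=1..l. n i)"
  using Union_block[where l = l and n = n] by auto

lemma block_in_rook:
  "k \<in> {1..l} \<Longrightarrow> i \<in> block n k \<Longrightarrow> (i, i) \<in> pverts (folded_rook (\<Sum>i=1..l. n i))"
  using block_subset by (auto simp: folded_rook_def)

lemma cell_in_rook: "(i, j) \<in> afr_cells l n \<Longrightarrow> (i, j) \<in> pverts (folded_rook (\<Sum>i=1..l. n i))"
  using block_subset by (fastforce simp: folded_rook_def afr_cells_def)

lemma folded_rook_arc_iff:
  "((i, j), (i', j')) \<in> parcs (folded_rook N) \<longleftrightarrow>
    (i, j) \<in> pverts (folded_rook N) \<and> (i', j') \<in> pverts (folded_rook N) \<and>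
    (i, j) \<noteq> (i', j') \<and> {i, j} \<inter> {i', j'} \<noteq> {}"
  by (auto simp: folded_rook_def)

lemma pverts_AFR:
  assumes "\<And>k. k \<in> {1..l} \<Longrightarrow> n k \<ge> 1"
  shows "pverts (AFR l n) = Contracted ` {1..l} \<union> (\<lambda>(i, j). Cell i j) ` afr_cells l n"
proof -
  let ?V = "pverts (folded_rook (\<Sum>i=1..l. n i))"
  have "afr_label l n ` ?V = Contracted ` {1..l} \<union> (\<lambda>(i, j). Cell i j) ` afr_cells l n"
  proof (intro equalityI subsetI)
    fix x assume "x \<in> afr_label l n ` ?V"
    then obtain i j where "(i, j) \<in> ?V" "x = afr_label l n (i, j)" by auto
    then show "x \<in> Contracted ` {1..l} \<union> (\<lambda>(i, j). Cell i j) ` afr_cells l n"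
      by (cases rule: folded_rook_cases) force+
  next
    fix x assume "x \<in> Contracted ` {1..l} \<union> (\<lambda>(i, j). Cell i j) ` afr_cells l n"
    then consider k where "k \<in> {1..l}" "x = Contracted k"
      | i j where "(i, j) \<in> afr_cells l n" "x = Cell i j" by auto
    then show "x \<in> afr_label l n ` ?V"
    proof cases
      case 1
      have "(\<Sum>i=1..k. n i) = (\<Sum>i=1..<k. n i) + n k"
        using 1(1) by (simp add: sum.last_plus add.commute)
      then have "(\<Sum>i=1..k. n i) \<in> block n k"
        using assms[OF 1(1)] by (simp add: block_def)
      then show ?thesis
        using 1 afr_label_Contracted[OF 1(1)] block_in_rook[OF 1(1)] by (metis image_eqI)
    next
      case 2
      then show ?thesis using cell_in_rook afr_label_cell by (metis image_eqI)
    qed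
  qed
  then show ?thesis
    by (simp add: AFR_def contract_def)
qed

lemma parcs_AFR:
  assumes "\<And>k. k \<in> {1..l} \<Longrightarrow> n k \<ge> 1"
  shows "parcs (AFR l n) = {(u, v). u \<in> pverts (AFR l n) \<and> v \<in> pverts (AFR l n) \<and> afr_adj l n u v}"
proof -
  let ?R = "folded_rook (\<Sum>i=1..l. n i)"
  let ?q = "afr_label l n"
  let ?D = "{(Cell i j, Cell i' j') | i j i' j'. \<exists>k\<in>{1..l}. \<exists>m\<in>{1..l}. k \<noteq> m \<and>
             (i, j) \<in> block n k \<times> block n m \<and> (i', j') \<in> block n k \<times> block n m}"
  have AFR: "parcs (AFR l n) = {(?q u, ?q v) | u v. (u, v) \<in> parcs ?R \<and> ?q u \<noteq> ?q v} - ?D"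
    and V: "pverts (AFR l n) = ?q ` pverts ?R"
    by (simp_all add: AFR_def contract_def)
  show ?thesis
  proof (intro equalityI subsetI)
    fix e assume e: "e \<in> parcs (AFR l n)"
    then obtain i j i' j' where uv: "((i, j), (i', j')) \<in> parcs ?R"
      "?q (i, j) \<noteq> ?q (i', j')" "e = (?q (i, j), ?q (i', j'))" "e \<notin> ?D"
      unfolding AFR by auto
    then have R: "(i, j) \<in> pverts ?R" "(i', j') \<in> pverts ?R" and meet: "{i, j} \<inter> {i', j'} \<noteq> {}"
      by (auto simp: folded_rook_arc_iff)
    have "afr_adj l n (?q (i, j)) (?q (i', j'))"
      using R(1)
    proof (cases rule: folded_rook_cases)
      case c1: (contracted k)
      show ?thesis using R(2)
      proof (cases rule: folded_rook_cases)
        case c2: (contracted m)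
        have "k = m" using c1 c2 meet block_disjoint by auto
        then show ?thesis using c1 c2 uv(2) by simp
      next
        case cell
        then show ?thesis using c1 meet by (auto simp: afr_adj_def)
      qed
    next
      case c1: cell
      show ?thesis using R(2)
      proof (cases rule: folded_rook_cases)
        case (contracted m)
        then show ?thesis using c1 meet by (auto simp: afr_adj_def)
      next
        case cell
        then show ?thesis using c1 meet uv by (auto simp: afr_adj_def)
      qed
    qed
    then show "e \<in> {(u, v). u \<in> pverts (AFR l n) \<and> v \<in> pverts (AFR l n) \<and> afr_adj l n u v}"
      using R uv(3) V by auto
  next
    fix e assume "e \<in> {(u, v). u \<in> pverts (AFR l n) \<and> v \<in> pverts (AFR l n) \<and> afr_adj l n u v}"
    then obtain u v where e: "e = (u, v)" and uv: "u \<in> pverts (AFR l n)" "v \<in> pverts (AFR l n)"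
      "afr_adj l n u v" by auto
    have V': "pverts (AFR l n) = Contracted ` {1..l} \<union> (\<lambda>(i, j). Cell i j) ` afr_cells l n"
      by (rule pverts_AFR) (rule assms)
    have cellD: "(i, j) \<in> afr_cells l n" if "Cell i j \<in> pverts (AFR l n)" for i j
      using that by (auto simp: V')
    have contrD: "k \<in> {1..l}" if "Contracted k \<in> pverts (AFR l n)" for k
      using that by (auto simp: V')
    have mixed: "\<exists>x. x \<in> block n k \<and> x \<in> {i, j} \<and> (x, x) \<in> pverts ?R \<and> ?q (x, x) = Contracted k \<and>
        (i, j) \<in> pverts ?R \<and> ?q (i, j) = Cell i j \<and> (x, x) \<noteq> (i, j)"
      if "k \<in> {1..l}" "(i, j) \<in> afr_cells l n" "{i, j} \<inter> block n k \<noteq> {}" for i j k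
    proof -
      from that(3) obtain x where "x \<in> {i, j}" "x \<in> block n k" by blast
      moreover have "(x, x) \<noteq> (i, j)" using that(2) by (auto simp: afr_cells_def)
      ultimately show ?thesis
        using block_in_rook cell_in_rook afr_label_cell afr_label_Contracted that by blast
    qed
    show "e \<in> parcs (AFR l n)"
    proof (cases u)
      case u: (Contracted k)
      show ?thesis
      proof (cases v)
        case (Contracted m)
        then show ?thesis using u uv(3) by (simp add: afr_adj_def)
      next
        case v: (Cell i j)
        have "{i, j} \<inter> block n k \<noteq> {}" using u v uv(3) by (simp add: afr_adj_def)
        then obtain x where x: "x \<in> {i, j}" "(x, x) \<in> pverts ?R" "?q (x, x) = Contracted k"
          "(i, j) \<in> pverts ?R" "?q (i, j) = Cell i j" "(x, x) \<noteq> (i, j)"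
          using mixed[of k i j] contrD[of k] cellD[of i j] u v uv by auto
        then have "((x, x), (i, j)) \<in> parcs ?R" by (auto simp: folded_rook_arc_iff)
        then have "(?q (x, x), ?q (i, j)) \<in> {(?q u, ?q v) | u v. (u, v) \<in> parcs ?R \<and> ?q u \<noteq> ?q v}"
          using x by fastforce
        then show ?thesis unfolding AFR using e u v x by auto
      qed
    next
      case u: (Cell i j)
      show ?thesis
      proof (cases v)
        case v: (Contracted k)
        have "{i, j} \<inter> block n k \<noteq> {}" using u v uv(3) by (simp add: afr_adj_def)
        then obtain x where x: "x \<in> {i, j}" "(x, x) \<in> pverts ?R" "?q (x, x) = Contracted k"
          "(i, j) \<in> pverts ?R" "?q (i, j) = Cell i j" "(x, x) \<noteq> (i, j)"
          using mixed[of k i j] contrD[of k] cellD[of i j] u v uv by auto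
        then have "((i, j), (x, x)) \<in> parcs ?R" by (auto simp: folded_rook_arc_iff)
        then have "(?q (i, j), ?q (x, x)) \<in> {(?q u, ?q v) | u v. (u, v) \<in> parcs ?R \<and> ?q u \<noteq> ?q v}"
          using x by fastforce
        then show ?thesis unfolding AFR using e u v x by auto
      next
        case v: (Cell i' j')
        have c: "(i, j) \<in> afr_cells l n" "(i', j') \<in> afr_cells l n"
          using u v uv cellD by auto
        have q: "?q (i, j) = Cell i j" "?q (i', j') = Cell i' j'"
          using c by (auto intro: afr_label_cell)
        have adj: "(i, j) \<noteq> (i', j')" "{i, j} \<inter> {i', j'} \<noteq> {}" "e \<notin> ?D"
          using uv(3) u v e by (auto simp: afr_adj_def)
        then have "((i, j), (i', j')) \<in> parcs ?R"
          using c cell_in_rook by (simp add: folded_rook_arc_iff)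
        then have "(?q (i, j), ?q (i', j')) \<in> {(?q u, ?q v) | u v. (u, v) \<in> parcs ?R \<and> ?q u \<noteq> ?q v}"
          using adj(1) q by (intro CollectI exI[of _ "(i, j)"] exI[of _ "(i', j')"]) auto
        then show ?thesis unfolding AFR using e u v q adj(3) by (intro DiffI) simp_all
      qed
    qed
  qed
qed

lemma pair_graph_AFR:
  assumes "\<And>k. k \<in> {1..l} \<Longrightarrow> n k \<ge> 1"
  shows "pair_graph (AFR l n)"
proof (rule pair_graphI)
  have A: "parcs (AFR l n) =
      {(u, v). u \<in> pverts (AFR l n) \<and> v \<in> pverts (AFR l n) \<and> afr_adj l n u v}"
    by (rule parcs_AFR) (rule assms)
  show "u \<in> pverts (AFR l n) \<and> u \<noteq> v \<and> (v, u) \<in> parcs (AFR l n)"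
    if "(u, v) \<in> parcs (AFR l n)" for u v
    using that afr_adj_irrefl afr_adj_sym unfolding A by blast
  have "pverts (folded_rook N) \<subseteq> {..N} \<times> {..N}" for N
    by (auto simp: folded_rook_def)
  then have "finite (pverts (folded_rook N))" for N
    by (rule finite_subset) simp
  then show "finite (pverts (AFR l n))"
    by (simp add: AFR_def contract_def)
qed

end

theory Submission
  imports Defs
begin

text \<open>
  The minimal dominating sets of a complete multipartite graph whose parts have at least two vertices
  are the parts and the pairs of vertices from different parts. Numbering the vertices part by part,
  the parts become the contracted vertices of the altered folded rook's graph and the pairs become its
  cells. Two pairs that share a vertex are adjacent in the reconfiguration graph iff the two remaining
  vertices lie in different parts; since the numbering is monotone in the part, the pairs
  with remaining vertices in the same part are those lying in a common \<open>N\<^sub>k \<times> N\<^sub>m\<close>.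
\<close>

section \<open>Minimal dominating sets of a complete multipartite graph\<close>

abbreviation part :: "(nat \<Rightarrow> nat) \<Rightarrow> nat \<Rightarrow> (nat \<times> nat) set" where
  "part n k \<equiv> {k} \<times> {1..n k}"

lemma pverts_complete_multipartite:
  "pverts (complete_multipartite l n) = (SIGMA k:{1..l}. {1..n k})"
  by (simp add: complete_multipartite_def Let_def)

lemma parcs_complete_multipartite_iff:
  "(u, v) \<in> parcs (complete_multipartite l n) \<longleftrightarrow>
    u \<in> pverts (complete_multipartite l n) \<and> v \<in> pverts (complete_multipartite l n) \<and> fst u \<noteq> fst v"
  by (simp add: complete_multipartite_def Let_def)

lemma part_subset_pverts: "k \<in> {1..l} \<Longrightarrow> part n k \<subseteq> pverts (complete_multipartite l n)"
  by (auto simp: pverts_complete_multipartite)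

lemma mem_part_fst: "u \<in> pverts (complete_multipartite l n) \<Longrightarrow> u \<in> part n (fst u)"
  by (auto simp: pverts_complete_multipartite)

lemma fst_mem_parts: "u \<in> pverts (complete_multipartite l n) \<Longrightarrow> fst u \<in> {1..l}"
  by (auto simp: pverts_complete_multipartite)

text \<open>Every vertex lies outside the part of \<open>u\<close> or outside that of
  \<open>v\<close>, and so is adjacent to one of them.\<close>

lemma dominating_set_pair:
  assumes "u \<in> pverts (complete_multipartite l n)" "v \<in> pverts (complete_multipartite l n)"
    and "fst u \<noteq> fst v"
  shows "dominating_set (complete_multipartite l n) {u, v}"
  using assms by (auto simp: dominating_set_def parcs_complete_multipartite_iff)

lemma dominating_set_part:
  assumes "k \<in> {1..l}" "n k \<ge> 1"
  shows "dominating_set (complete_multipartite l n) (part n k)"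
proof -
  \<comment> \<open>This one vertex dominates all the other parts; the vertices of part
    \<open>k\<close> are in the set themselves.\<close>
  have "(k, 1) \<in> part n k" using assms by simp
  then show ?thesis
    using assms part_subset_pverts[OF assms(1)] mem_part_fst
    unfolding dominating_set_def parcs_complete_multipartite_iff
    by (metis fst_conv subsetD)
qed

text \<open>A vertex of part \<open>k\<close> has no neighbour in its own part, so a set confined to
  that part can dominate it only by containing it.\<close>

lemma part_subset_dominating_set:
  assumes "dominating_set (complete_multipartite l n) S" "k \<in> {1..l}" "\<And>u. u \<in> S \<Longrightarrow> fst u = k"
  shows "part n k \<subseteq> S"
  using assms part_subset_pverts[OF assms(2)]
  by (fastforce simp: dominating_set_def parcs_complete_multipartite_iff)

lemma minimal_dominating_set_part:
  assumes "k \<in> {1..l}" "n k \<ge> 1"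
  shows "minimal_dominating_set (complete_multipartite l n) (part n k)"
proof -
  have False if "T \<subset> part n k" "dominating_set (complete_multipartite l n) T" for T
  proof -
    have "part n k \<subseteq> T"
      using that(1) by (intro part_subset_dominating_set[OF that(2) assms(1)]) auto
    then show False using that(1) by blast
  qed
  then show ?thesis
    using dominating_set_part[of k l n, OF assms] by (auto simp: minimal_dominating_set_def)
qed

lemma minimal_dominating_set_pair:
  assumes "\<And>k. k \<in> {1..l} \<Longrightarrow> n k \<ge> 2"
    and u: "u \<in> pverts (complete_multipartite l n)" and v: "v \<in> pverts (complete_multipartite l n)"
    and "fst u \<noteq> fst v"
  shows "minimal_dominating_set (complete_multipartite l n) {u, v}"
proof -
  have no: "\<not> dominating_set (complete_multipartite l n) T"
    if "T \<subseteq> {w}" "w \<in> pverts (complete_multipartite l n)" for T w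
  proof
    assume "dominating_set (complete_multipartite l n) T"
    \<comment> \<open>This covers empty \<open>T\<close> too: the condition that all elements of
      \<open>T\<close> lie in the part of \<open>w\<close> then holds vacuously.\<close>
    then have "part n (fst w) \<subseteq> T"
      using that fst_mem_parts[OF that(2)] by (intro part_subset_dominating_set) auto
    moreover have "(fst w, 1) \<in> part n (fst w)" "(fst w, 2) \<in> part n (fst w)"
      using assms(1)[OF fst_mem_parts[OF that(2)]] by auto
    ultimately have "(fst w, 1::nat) = w" "(fst w, 2::nat) = w"
      using that(1) by blast+
    then show False by (metis one_eq_numeral_iff prod.inject semiring_norm(83))
  qed
  have "\<not> dominating_set (complete_multipartite l n) T" if "T \<subset> {u, v}" for T
  proof -
    have "T \<subseteq> {u} \<or> T \<subseteq> {v}" using that by auto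
    then show ?thesis using no u v by blast
  qed
  then show ?thesis
    using dominating_set_pair[OF u v assms(4)] by (simp add: minimal_dominating_set_def)
qed

text \<open>If \<open>M\<close> meets two parts, it contains a dominating pair; otherwise it lies in
  one part and contains all of it. Minimality turns either inclusion into an equality.\<close>

lemma minimal_dominating_set_cases:
  assumes M: "minimal_dominating_set (complete_multipartite l n) M"
    and "pverts (complete_multipartite l n) \<noteq> {}"
  obtains (part) k where "k \<in> {1..l}" "M = part n k"
    | (pair) u v where "u \<in> pverts (complete_multipartite l n)"
        "v \<in> pverts (complete_multipartite l n)" "fst u \<noteq> fst v" "M = {u, v}"
proof -
  have dom: "dominating_set (complete_multipartite l n) M"
    and sub: "M \<subseteq> pverts (complete_multipartite l n)"
    using M by (auto simp: minimal_dominating_set_def dominating_set_def)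
  have min: "T = M" if "T \<subseteq> M" "dominating_set (complete_multipartite l n) T" for T
    using M that by (auto simp: minimal_dominating_set_def)
  show thesis
  proof (cases "\<exists>u\<in>M. \<exists>v\<in>M. fst u \<noteq> fst v")
    case True
    then obtain u v where "u \<in> M" "v \<in> M" "fst u \<noteq> fst v" by blast
    then show thesis
      using pair[of u v] min[of "{u, v}"] dominating_set_pair[of u l n v] sub by auto
  next
    case False
    \<comment> \<open>The empty set dominates only the empty graph.\<close>
    from dom assms(2) obtain w where w: "w \<in> M"
      unfolding dominating_set_def by blast
    then have "w \<in> pverts (complete_multipartite l n)" using sub by blast
    then have k: "fst w \<in> {1..l}" and n: "n (fst w) \<ge> 1"
      by (auto simp: pverts_complete_multipartite)
    have "part n (fst w) \<subseteq> M"
      using False w by (intro part_subset_dominating_set[OF dom k]) blast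
    then have "M = part n (fst w)"
      using min dominating_set_part[of "fst w" l n, OF k n] by blast
    then show thesis using part k by blast
  qed
qed

section \<open>Adjacency in the reconfiguration graph\<close>

lemma reconf_adj_sym: "reconf_adj G A B \<longleftrightarrow> reconf_adj G B A"
  by (auto simp: reconf_adj_def)

text \<open>Adjacency requires one of the two set differences to be a singleton, but distinct parts
  are disjoint and have at least two elements each.\<close>

lemma not_reconf_adj_parts:
  assumes "n k \<ge> 2" "n m \<ge> 2"
  shows "\<not> reconf_adj G (part n k) (part n m)"
proof (cases "k = m")
  case False
  have *: "part n a - part n b \<noteq> {v}" if "a \<noteq> b" "n a \<ge> 2" for a b v
  proof
    assume "part n a - part n b = {v}"
    moreover have "(a, 1) \<in> part n a - part n b" "(a, 2) \<in> part n a - part n b"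
      using that by auto
    ultimately have "(a, 1::nat) = v" "(a, 2::nat) = v" by blast+
    then show False by auto
  qed
  show ?thesis
    using *[of k m] *[of m k] False assms unfolding reconf_adj_def by blast
qed (auto simp: reconf_adj_def)

text \<open>A part disjoint from the pair leaves two differences with at least two elements each. If
  the part contains \<open>u\<close>, only \<open>v\<close> is added, and all removed vertices are
  neighbours of \<open>v\<close> because they lie in the part of \<open>u\<close>.\<close>

lemma reconf_adj_part_pair_iff:
  assumes "k \<in> {1..l}" "n k \<ge> 2"
    and u: "u \<in> pverts (complete_multipartite l n)" and v: "v \<in> pverts (complete_multipartite l n)"
    and "fst u \<noteq> fst v"
  shows "reconf_adj (complete_multipartite l n) (part n k) {u, v} \<longleftrightarrow> k = fst u \<or> k = fst v"
proof
  assume adj: "reconf_adj (complete_multipartite l n) (part n k) {u, v}"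
  show "k = fst u \<or> k = fst v"
  proof (rule ccontr)
    assume "\<not> (k = fst u \<or> k = fst v)"
    then have "{u, v} - part n k = {u, v}" "part n k - {u, v} = part n k" by auto
    moreover have "part n k \<noteq> {w}" for w
    proof
      assume "part n k = {w}"
      moreover have "(k, 1) \<in> part n k" "(k, 2) \<in> part n k"
        using assms(2) by auto
      ultimately have "(k, 1::nat) = w" "(k, 2::nat) = w" by blast+
      then show False by auto
    qed
    moreover have "{u, v} \<noteq> {w}" for w using assms(5) by auto
    ultimately show False using adj unfolding reconf_adj_def by auto
  qed
next
  have *: "reconf_adj (complete_multipartite l n) (part n (fst a)) {a, b}"
    if "a \<in> pverts (complete_multipartite l n)" "b \<in> pverts (complete_multipartite l n)"
      "fst a \<noteq> fst b" for a b
  proof -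
    have "{a, b} - part n (fst a) = {b}"
      using that mem_part_fst[OF that(1)] by auto
    moreover have "part n (fst a) - {a, b} \<subseteq> open_nbhd (complete_multipartite l n) b"
      using that part_subset_pverts[OF fst_mem_parts[OF that(1)]]
      by (fastforce simp: open_nbhd_def parcs_complete_multipartite_iff)
    ultimately show ?thesis using that(2) by (auto simp: reconf_adj_def)
  qed
  assume "k = fst u \<or> k = fst v"
  then show "reconf_adj (complete_multipartite l n) (part n k) {u, v}"
    using *[OF u v] *[OF v u] assms(5) by (auto simp: insert_commute)
qed

text \<open>Distinct pairs with a common vertex differ by one vertex on each side, so they are
  adjacent iff these two vertices are. The disjuncts list the possible positions of the common
  vertex, matching \<open>afr_adj_cells_iff\<close>.\<close>

lemma reconf_adj_pairs_iff:
  assumes "{u, v, u', v'} \<subseteq> pverts (complete_multipartite l n)" "fst u \<noteq> fst v" "fst u' \<noteq> fst v'"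
  shows "reconf_adj (complete_multipartite l n) {u, v} {u', v'} \<longleftrightarrow>
    u = u' \<and> fst v \<noteq> fst v' \<or> u = v' \<and> fst v \<noteq> fst u' \<or>
    v = u' \<and> fst u \<noteq> fst v' \<or> v = v' \<and> fst u \<noteq> fst u'"
    (is "?L \<longleftrightarrow> _")
proof -
  have uv: "u \<noteq> v" "u' \<noteq> v'" using assms by auto
  have swap: "reconf_adj (complete_multipartite l n) {a, b} {a, c} \<longleftrightarrow> fst b \<noteq> fst c"
    if "a \<noteq> b" "a \<noteq> c" "b \<in> pverts (complete_multipartite l n)"
      "c \<in> pverts (complete_multipartite l n)" for a b c
  proof (cases "b = c")
    case False
    then have "{a, b} - {a, c} = {b}" "{a, c} - {a, b} = {c}" using that by auto
    then have "reconf_adj (complete_multipartite l n) {a, b} {a, c} \<longleftrightarrow>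
        b \<in> open_nbhd (complete_multipartite l n) c \<or> c \<in> open_nbhd (complete_multipartite l n) b"
      unfolding reconf_adj_def using that(3,4) by (simp only:) blast
    then show ?thesis
      using that(3,4) by (auto simp: open_nbhd_def parcs_complete_multipartite_iff)
  next
    case True
    then show ?thesis unfolding reconf_adj_def by blast
  qed
  consider "u = u'" | "u = v'" | "v = u'" | "v = v'" | "{u, v} \<inter> {u', v'} = {}" by auto
  then show ?thesis
  proof cases
    case 1
    then have "{u, v} = {u, v}" "{u', v'} = {u, v'}" by auto
    moreover have "reconf_adj (complete_multipartite l n) {u, v} {u, v'} \<longleftrightarrow> fst v \<noteq> fst v'"
      using 1 uv assms(1) by (intro swap) auto
    ultimately have "?L \<longleftrightarrow> fst v \<noteq> fst v'" by (simp only:)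
    \<comment> \<open>The other disjuncts fail: \<open>u = v'\<close> or \<open>v = u'\<close> would
      make the two vertices of a pair equal, and \<open>fst u \<noteq> fst u'\<close> contradicts
      \<open>u = u'\<close>. The next three cases are analogous.\<close>
    then show ?thesis using 1 uv assms(2,3) by metis
  next
    case 2
    then have "{u, v} = {u, v}" "{u', v'} = {u, u'}" by auto
    moreover have "reconf_adj (complete_multipartite l n) {u, v} {u, u'} \<longleftrightarrow> fst v \<noteq> fst u'"
      using 2 uv assms(1) by (intro swap) auto
    ultimately have "?L \<longleftrightarrow> fst v \<noteq> fst u'" by (simp only:)
    then show ?thesis using 2 uv assms(2,3) by metis
  next
    case 3
    then have "{u, v} = {v, u}" "{u', v'} = {v, v'}" by auto
    moreover have "reconf_adj (complete_multipartite l n) {v, u} {v, v'} \<longleftrightarrow> fst u \<noteq> fst v'"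
      using 3 uv assms(1) by (intro swap) auto
    ultimately have "?L \<longleftrightarrow> fst u \<noteq> fst v'" by (simp only:)
    then show ?thesis using 3 uv assms(2,3) by metis
  next
    case 4
    then have "{u, v} = {v, u}" "{u', v'} = {v, u'}" by auto
    moreover have "reconf_adj (complete_multipartite l n) {v, u} {v, u'} \<longleftrightarrow> fst u \<noteq> fst u'"
      using 4 uv assms(1) by (intro swap) auto
    ultimately have "?L \<longleftrightarrow> fst u \<noteq> fst u'" by (simp only:)
    then show ?thesis using 4 uv assms(2,3) by metis
  next
    case 5
    then have "{u, v} - {u', v'} = {u, v}" "{u', v'} - {u, v} = {u', v'}" by auto
    moreover have "{u, v} \<noteq> {w}" "{u', v'} \<noteq> {w}" for w using uv by auto
    ultimately have "\<not> ?L" unfolding reconf_adj_def by (simp only:) blast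
    moreover have "u \<noteq> u'" "u \<noteq> v'" "v \<noteq> u'" "v \<noteq> v'" using 5 by auto
    ultimately show ?thesis by blast
  qed
qed

section \<open>Numbering the vertices part by part\<close>

definition vertex_number :: "(nat \<Rightarrow> nat) \<Rightarrow> nat \<times> nat \<Rightarrow> nat" where
  "vertex_number n = (\<lambda>(k, a). (\<Sum>i=1..<k. n i) + a)"

lemma vertex_number_image_part:
  assumes "k \<ge> 1"
  shows "vertex_number n ` part n k = block n k"
proof -
  \<comment> \<open>Splitting off the last summand needs \<open>k \<ge> 1\<close>: for
    \<open>k = 0\<close> the left-hand sum is empty.\<close>
  have "(\<Sum>i=1..k. n i) = (\<Sum>i=1..<k. n i) + n k"
    using assms by (simp add: sum.last_plus add.commute)
  then have "block n k = (+) (\<Sum>i=1..<k. n i) ` {1..n k}"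
    by (simp add: block_def)
  moreover have "part n k = Pair k ` {1..n k}" by auto
  ultimately show ?thesis by (simp add: vertex_number_def image_image)
qed

text \<open>The blocks cover the range. Vertices with equal numbers lie in the same part because
  blocks are disjoint, and then the common offset cancels.\<close>

lemma bij_betw_vertex_number:
  "bij_betw (vertex_number n) (pverts (complete_multipartite l n)) {1..(\<Sum>i=1..l. n i)}"
proof -
  have "pverts (complete_multipartite l n) = (\<Union>k\<in>{1..l}. part n k)"
    by (auto simp: pverts_complete_multipartite)
  then have "vertex_number n ` pverts (complete_multipartite l n) =
      (\<Union>k\<in>{1..l}. vertex_number n ` part n k)"
    by (simp only: image_UN)
  also have "\<dots> = (\<Union>k\<in>{1..l}. block n k)"
    using vertex_number_image_part by (intro SUP_cong) auto
  finally have img: "vertex_number n ` pverts (complete_multipartite l n) = {1..(\<Sum>i=1..l. n i)}"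
    by (simp only: Union_block)
  have "u = v" if uv: "u \<in> pverts (complete_multipartite l n)"
    "v \<in> pverts (complete_multipartite l n)" "vertex_number n u = vertex_number n v" for u v
  proof -
    have pos: "1 \<le> fst u" "1 \<le> fst v" using uv(1,2)[THEN fst_mem_parts] by auto
    have "vertex_number n u \<in> block n (fst u)" "vertex_number n v \<in> block n (fst v)"
      using imageI[OF mem_part_fst[OF uv(1)]] imageI[OF mem_part_fst[OF uv(2)]]
        vertex_number_image_part[OF pos(1)] vertex_number_image_part[OF pos(2)] by metis+
    then have "fst u = fst v" unfolding uv(3) using pos by (rule block_disjoint)
    then show ?thesis using uv(3) by (auto simp: vertex_number_def split: prod.splits)
  qed
  then show ?thesis using img by (auto simp: bij_betw_def inj_on_def)
qed

text \<open>Block \<open>k\<close> ends at a partial sum that the offset of block \<open>m\<close>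
  already includes. This makes the numbering monotone in the part.\<close>

lemma block_less:
  assumes "x \<in> block n k" "y \<in> block n m" "k < m"
  shows "x < y"
proof -
  have "(\<Sum>i=1..k. n i) \<le> (\<Sum>i=1..<m. n i)"
    using assms(3) by (intro sum_mono2) auto
  then show ?thesis using assms by (auto simp: block_def)
qed

text \<open>Cells are given by numbers, so the inverse of the numbering is what reads them as
  vertices; it is meaningful only on \<open>{1..(\<Sum>i=1..l. n i)}\<close>.\<close>

definition numbered_vertex :: "nat \<Rightarrow> (nat \<Rightarrow> nat) \<Rightarrow> nat \<Rightarrow> nat \<times> nat" where
  "numbered_vertex l n = inv_into (pverts (complete_multipartite l n)) (vertex_number n)"

lemma bij_betw_numbered_vertex:
  "bij_betw (numbered_vertex l n) {1..(\<Sum>i=1..l. n i)} (pverts (complete_multipartite l n))"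
  unfolding numbered_vertex_def by (rule bij_betw_inv_into[OF bij_betw_vertex_number])

lemma numbered_vertex_mem:
  "i \<in> {1..(\<Sum>i=1..l. n i)} \<Longrightarrow> numbered_vertex l n i \<in> pverts (complete_multipartite l n)"
  by (rule bij_betw_apply[OF bij_betw_numbered_vertex])

lemma numbered_vertex_eq_iff:
  "i \<in> {1..(\<Sum>i=1..l. n i)} \<Longrightarrow> j \<in> {1..(\<Sum>i=1..l. n i)} \<Longrightarrow>
    numbered_vertex l n i = numbered_vertex l n j \<longleftrightarrow> i = j"
  by (rule inj_on_eq_iff[OF bij_betw_imp_inj_on[OF bij_betw_numbered_vertex]])

text \<open>The vertex numbered \<open>i\<close> has its number in the block of its own part, and
  blocks are disjoint. This translates conditions on blocks into conditions on parts.\<close>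

lemma mem_block_iff:
  assumes "i \<in> {1..(\<Sum>i=1..l. n i)}" "k \<in> {1..l}"
  shows "i \<in> block n k \<longleftrightarrow> fst (numbered_vertex l n i) = k"
proof -
  let ?u = "numbered_vertex l n i"
  have u: "?u \<in> pverts (complete_multipartite l n)" using assms(1) by (rule numbered_vertex_mem)
  have "vertex_number n ?u = i"
    unfolding numbered_vertex_def
    using bij_betw_inv_into_right[OF bij_betw_vertex_number assms(1)] .
  moreover have pos: "1 \<le> fst ?u" using fst_mem_parts[OF u] by simp
  ultimately have "i \<in> block n (fst ?u)"
    using imageI[OF mem_part_fst[OF u]] vertex_number_image_part[OF pos] by metis
  then show ?thesis using block_disjoint[OF _ _ _ pos, of i n k] assms(2) by auto
qed

lemma fst_numbered_vertex_less:
  assumes "i \<in> {1..(\<Sum>i=1..l. n i)}" "j \<in> {1..(\<Sum>i=1..l. n i)}"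
    and "fst (numbered_vertex l n i) < fst (numbered_vertex l n j)"
  shows "i < j"
proof (rule block_less[OF _ _ assms(3)])
  show "i \<in> block n (fst (numbered_vertex l n i))"
    using mem_block_iff[OF assms(1) fst_mem_parts[OF numbered_vertex_mem[OF assms(1)]]] by simp
  show "j \<in> block n (fst (numbered_vertex l n j))"
    using mem_block_iff[OF assms(2) fst_mem_parts[OF numbered_vertex_mem[OF assms(2)]]] by simp
qed

section \<open>Cells and their adjacency in terms of parts\<close>

text \<open>For numbers in different blocks, the order of the numbers is the order of the parts.
  Hence every unordered pair of vertices from different parts gives exactly one cell.\<close>

lemma afr_cells_iff:
  "(i, j) \<in> afr_cells l n \<longleftrightarrow> i \<in> {1..(\<Sum>i=1..l. n i)} \<and> j \<in> {1..(\<Sum>i=1..l. n i)} \<and>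
    fst (numbered_vertex l n j) < fst (numbered_vertex l n i)"
proof
  assume "(i, j) \<in> afr_cells l n"
  then obtain k m where km: "j < i" "k \<in> {1..l}" "m \<in> {1..l}" "k \<noteq> m" "i \<in> block n k" "j \<in> block n m"
    by (auto simp: afr_cells_def)
  then have ij: "i \<in> {1..(\<Sum>i=1..l. n i)}" "j \<in> {1..(\<Sum>i=1..l. n i)}"
    using block_subset by auto
  then have "fst (numbered_vertex l n i) = k" "fst (numbered_vertex l n j) = m"
    using km mem_block_iff by blast+
  then show "i \<in> {1..(\<Sum>i=1..l. n i)} \<and> j \<in> {1..(\<Sum>i=1..l. n i)} \<and>
      fst (numbered_vertex l n j) < fst (numbered_vertex l n i)"
    \<comment> \<open>The parts differ, and the opposite order would give
      \<open>i < j\<close>.\<close>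
    using ij km fst_numbered_vertex_less[of i n l j] by linarith
next
  assume A: "i \<in> {1..(\<Sum>i=1..l. n i)} \<and> j \<in> {1..(\<Sum>i=1..l. n i)} \<and>
    fst (numbered_vertex l n j) < fst (numbered_vertex l n i)"
  then have "j < i" using fst_numbered_vertex_less by blast
  moreover have "fst (numbered_vertex l n i) \<in> {1..l}" "fst (numbered_vertex l n j) \<in> {1..l}"
    using A fst_mem_parts numbered_vertex_mem by blast+
  moreover from this have "i \<in> block n (fst (numbered_vertex l n i))"
      "j \<in> block n (fst (numbered_vertex l n j))"
    using A mem_block_iff[where l = l] by simp_all
  moreover have "fst (numbered_vertex l n i) \<noteq> fst (numbered_vertex l n j)" using A by simp
  ultimately show "(i, j) \<in> afr_cells l n"
    unfolding afr_cells_def by blast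
qed

lemma afr_adj_cells_iff:
  assumes c: "(i, j) \<in> afr_cells l n" "(i', j') \<in> afr_cells l n"
  defines "p \<equiv> \<lambda>x. fst (numbered_vertex l n x)"
  shows "afr_adj l n (Cell i j) (Cell i' j') \<longleftrightarrow>
    i = i' \<and> p j \<noteq> p j' \<or> i = j' \<and> p j \<noteq> p i' \<or> j = i' \<and> p i \<noteq> p j' \<or> j = j' \<and> p i \<noteq> p i'"
proof -
  let ?N = "\<Sum>i=1..l. n i"
  have mem: "i \<in> {1..?N}" "j \<in> {1..?N}" "i' \<in> {1..?N}" "j' \<in> {1..?N}"
    and less: "p j < p i" "p j' < p i'"
    using c by (auto simp: afr_cells_iff p_def)
  have pl: "p i \<in> {1..l}" "p j \<in> {1..l}"
    using mem fst_mem_parts numbered_vertex_mem unfolding p_def by blast+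
  have "(\<exists>k\<in>{1..l}. \<exists>m\<in>{1..l}. k \<noteq> m \<and>
      (i, j) \<in> block n k \<times> block n m \<and> (i', j') \<in> block n k \<times> block n m) \<longleftrightarrow>
    (\<exists>k\<in>{1..l}. \<exists>m\<in>{1..l}. k \<noteq> m \<and> p i = k \<and> p j = m \<and> p i' = k \<and> p j' = m)"
    unfolding p_def
    by (intro bex_cong refl) (simp only: mem_Times_iff fst_conv snd_conv mem_block_iff[where l = l] mem conj_assoc)
  \<comment> \<open>The only possible witnesses are \<open>p i\<close> and \<open>p j\<close>; they
    differ since \<open>p j < p i\<close>.\<close>
  also have "\<dots> \<longleftrightarrow> p i = p i' \<and> p j = p j'"
    using pl less by auto
  finally have same: "(\<exists>k\<in>{1..l}. \<exists>m\<in>{1..l}. k \<noteq> m \<and>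
      (i, j) \<in> block n k \<times> block n m \<and> (i', j') \<in> block n k \<times> block n m) \<longleftrightarrow>
      p i = p i' \<and> p j = p j'" .
  have "afr_adj l n (Cell i j) (Cell i' j') \<longleftrightarrow>
      (i, j) \<noteq> (i', j') \<and> {i, j} \<inter> {i', j'} \<noteq> {} \<and> \<not> (p i = p i' \<and> p j = p j')"
    unfolding same[symmetric] by (simp add: afr_adj_def)
  \<comment> \<open>If the shared number has opposite positions, say \<open>i = j'\<close>, then
    \<open>p j < p i = p j' < p i'\<close>, so both sides hold. If it has the same position, the
    parts of the other two numbers decide.\<close>
  then show ?thesis using less by auto
qed

section \<open>The isomorphism\<close>

text \<open>The inverse of the desired isomorphism; in this direction it has an explicit
  formula.\<close>

fun afr_set :: "nat \<Rightarrow> (nat \<Rightarrow> nat) \<Rightarrow> afr_vertex \<Rightarrow> (nat \<times> nat) set" where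
  "afr_set l n (Contracted k) = part n k"
| "afr_set l n (Cell i j) = {numbered_vertex l n i, numbered_vertex l n j}"

lemma afr_vertex_cases:
  assumes "x \<in> pverts (AFR l n)" "\<forall>k\<in>{1..l}. n k \<ge> 1"
  obtains (contracted) k where "k \<in> {1..l}" "x = Contracted k"
    | (cell) i j where "(i, j) \<in> afr_cells l n" "x = Cell i j"
  using assms pverts_AFR[of l n] by auto

lemma numbered_vertex_cell:
  assumes "(i, j) \<in> afr_cells l n"
  shows "numbered_vertex l n i \<in> pverts (complete_multipartite l n)"
    and "numbered_vertex l n j \<in> pverts (complete_multipartite l n)"
    and "fst (numbered_vertex l n i) \<noteq> fst (numbered_vertex l n j)"
  using assms by (auto simp: afr_cells_iff intro: numbered_vertex_mem)

lemma part_neq_pair: "fst u \<noteq> fst v \<Longrightarrow> part n k \<noteq> {u, v}"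
  by (metis SigmaE fst_conv insertI1 insertI2 singletonD)

lemma inj_on_afr_set:
  assumes n: "\<forall>k\<in>{1..l}. n k \<ge> 1"
  shows "inj_on (afr_set l n) (pverts (AFR l n))"
proof (rule inj_onI)
  fix x y assume x: "x \<in> pverts (AFR l n)" and y: "y \<in> pverts (AFR l n)"
    and eq: "afr_set l n x = afr_set l n y"
  show "x = y" using x n
  proof (cases rule: afr_vertex_cases)
    case k: (contracted k)
    show ?thesis using y n
    proof (cases rule: afr_vertex_cases)
      case (contracted m)
      have "(k, 1) \<in> part n k" using n k(1) by simp
      then have "k = m" using eq k contracted by auto
      then show ?thesis using k contracted by simp
    next
      case (cell i j)
      then show ?thesis using eq k numbered_vertex_cell part_neq_pair by simp
    qed
  next
    case ij: (cell i j)
    show ?thesis using y n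
    proof (cases rule: afr_vertex_cases)
      case (contracted m)
      then have "part n m = {numbered_vertex l n i, numbered_vertex l n j}"
        using eq ij(2) by simp
      then show ?thesis using part_neq_pair[OF numbered_vertex_cell(3)[OF ij(1)]] by (rule notE[rotated])
    next
      case (cell i' j')
      \<comment> \<open>Equal pairs could a priori come from swapped entries, but in both cells the
        second entry belongs to the smaller part.\<close>
      then show ?thesis using eq ij
        by (auto simp: afr_cells_iff doubleton_eq_iff numbered_vertex_eq_iff)
    qed
  qed
qed

lemma afr_set_image:
  assumes "l \<ge> 1" and n: "\<And>k. k \<in> {1..l} \<Longrightarrow> n k \<ge> 2"
  shows "afr_set l n ` pverts (AFR l n) = {M. minimal_dominating_set (complete_multipartite l n) M}"
proof (intro equalityI subsetI)
  have n1: "\<forall>k\<in>{1..l}. n k \<ge> 1" using n by force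
  have V: "pverts (AFR l n) = Contracted ` {1..l} \<union> (\<lambda>(i, j). Cell i j) ` afr_cells l n"
    using n1 by (intro pverts_AFR) blast
  fix M
  show "M \<in> {M. minimal_dominating_set (complete_multipartite l n) M}"
    if M: "M \<in> afr_set l n ` pverts (AFR l n)"
  proof -
    from M obtain x where x: "x \<in> pverts (AFR l n)" "M = afr_set l n x" by blast
    have "minimal_dominating_set (complete_multipartite l n) (afr_set l n x)"
      using x(1) n1
    proof (cases rule: afr_vertex_cases)
      case (contracted k)
      then show ?thesis using n1 minimal_dominating_set_part by simp
    next
      case (cell i j)
      then show ?thesis using numbered_vertex_cell minimal_dominating_set_pair[OF n] by simp
    qed
    then show ?thesis using x by simp
  qed
  show "M \<in> afr_set l n ` pverts (AFR l n)"
    if "M \<in> {M. minimal_dominating_set (complete_multipartite l n) M}"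
  proof -
    from that have "minimal_dominating_set (complete_multipartite l n) M" by simp
    moreover have "(1, 1) \<in> pverts (complete_multipartite l n)"
      using assms(1) n[of 1] by (simp add: pverts_complete_multipartite)
    then have "pverts (complete_multipartite l n) \<noteq> {}" by blast
    ultimately show ?thesis
    proof (cases rule: minimal_dominating_set_cases)
      case (part k)
      then show ?thesis using V by (intro image_eqI[of _ _ "Contracted k"]) auto
    next
      case (pair u v)
      \<comment> \<open>The vertex in the larger part must supply the first entry of the cell, so
        the pair is ordered by part before its numbers are taken.\<close>
      have *: "{a, b} \<in> afr_set l n ` pverts (AFR l n)"
        if ab: "a \<in> pverts (complete_multipartite l n)" "b \<in> pverts (complete_multipartite l n)"
          "fst b < fst a" for a b
      proof -
        from ab obtain i j where ij: "i \<in> {1..(\<Sum>i=1..l. n i)}" "j \<in> {1..(\<Sum>i=1..l. n i)}"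
          "a = numbered_vertex l n i" "b = numbered_vertex l n j"
          using bij_betw_imp_surj_on[OF bij_betw_numbered_vertex] by (metis imageE)
        then have "(i, j) \<in> afr_cells l n" using ab(3) by (simp add: afr_cells_iff)
        then have "Cell i j \<in> pverts (AFR l n)" unfolding V by force
        then show ?thesis using ij by (intro image_eqI[of _ _ "Cell i j"]) auto
      qed
      show ?thesis
        using *[OF pair(1,2)] *[OF pair(2,1)] pair(3,4) by (auto simp: insert_commute neq_iff)
    qed
  qed
qed

lemma afr_adj_iff_reconf_adj:
  assumes n: "\<And>k. k \<in> {1..l} \<Longrightarrow> n k \<ge> 2"
    and x: "x \<in> pverts (AFR l n)" and y: "y \<in> pverts (AFR l n)"
  shows "afr_adj l n x y \<longleftrightarrow>
    reconf_adj (complete_multipartite l n) (afr_set l n x) (afr_set l n y)"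
proof -
  have n1: "\<forall>k\<in>{1..l}. n k \<ge> 1" using n by force
  have mixed: "afr_adj l n (Contracted k) (Cell i j) \<longleftrightarrow>
      reconf_adj (complete_multipartite l n) (afr_set l n (Contracted k)) (afr_set l n (Cell i j))"
    if k: "k \<in> {1..l}" and c: "(i, j) \<in> afr_cells l n" for k i j
  proof -
    have "i \<in> {1..(\<Sum>i=1..l. n i)}" "j \<in> {1..(\<Sum>i=1..l. n i)}"
      using c by (auto simp: afr_cells_iff)
    then have "afr_adj l n (Contracted k) (Cell i j) \<longleftrightarrow>
        k = fst (numbered_vertex l n i) \<or> k = fst (numbered_vertex l n j)"
      using mem_block_iff[OF _ k] by (auto simp: afr_adj_def)
    then show ?thesis
      using reconf_adj_part_pair_iff[OF k n[OF k] numbered_vertex_cell[OF c]] by simp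
  qed
  show ?thesis using x n1
  proof (cases rule: afr_vertex_cases)
    case k: (contracted k)
    show ?thesis using y n1
    proof (cases rule: afr_vertex_cases)
      case (contracted m)
      then show ?thesis using k n not_reconf_adj_parts by (simp add: afr_adj_def)
    next
      case (cell i j)
      then show ?thesis using k mixed by blast
    qed
  next
    case ij: (cell i j)
    show ?thesis using y n1
    proof (cases rule: afr_vertex_cases)
      case (contracted m)
      then show ?thesis using ij mixed reconf_adj_sym afr_adj_sym by metis
    next
      case (cell i' j')
      have mem: "i \<in> {1..(\<Sum>i=1..l. n i)}" "j \<in> {1..(\<Sum>i=1..l. n i)}"
        "i' \<in> {1..(\<Sum>i=1..l. n i)}" "j' \<in> {1..(\<Sum>i=1..l. n i)}"
        using ij cell by (auto simp: afr_cells_iff)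
      note ab = numbered_vertex_cell[OF ij(1)] and ab' = numbered_vertex_cell[OF cell(1)]
      have "{numbered_vertex l n i, numbered_vertex l n j,
          numbered_vertex l n i', numbered_vertex l n j'} \<subseteq> pverts (complete_multipartite l n)"
        using ab ab' by simp
      \<comment> \<open>The two adjacency criteria agree disjunct by disjunct once equality of
        vertices is replaced by equality of numbers.\<close>
      from reconf_adj_pairs_iff[OF this ab(3) ab'(3)] show ?thesis
        by (simp only: ij(2) cell(2) afr_set.simps afr_adj_cells_iff[OF ij(1) cell(1)]
            numbered_vertex_eq_iff mem)
    qed
  qed
qed

lemma pair_graph_imp_pair_wf_digraph:
  assumes "pair_graph G"
  shows "pair_wf_digraph G"
proof -
  interpret pair_graph G by (rule assms)
  show ?thesis by unfold_locales
qed

theorem theorem6: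
  fixes l :: nat and n :: "nat \<Rightarrow> nat"
  assumes "l \<ge> 2"
    and "\<And>k. k \<in> {1..l} \<Longrightarrow> n k \<ge> 2"
  shows "digraph_iso (with_proj (reconf_graph (complete_multipartite l n))) (with_proj (AFR l n))"
proof -
  let ?R = "reconf_graph (complete_multipartite l n)"
  \<comment> \<open>The isomorphism is to start from the reconfiguration graph, so
    \<open>afr_set\<close> is inverted.\<close>
  let ?f = "inv_into (pverts (AFR l n)) (afr_set l n)"
  have n1: "\<forall>k\<in>{1..l}. n k \<ge> 1" using assms(2) by force
  have "l \<ge> 1" using assms(1) by simp
  then have img: "afr_set l n ` pverts (AFR l n) = pverts ?R"
    using afr_set_image assms(2) by (simp add: reconf_graph_def)
  then have bij: "bij_betw ?f (pverts ?R) (pverts (AFR l n))"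
    using inj_on_afr_set[OF n1] by (intro bij_betw_inv_into) (simp add: bij_betw_def)
  have "(A, B) \<in> parcs ?R \<longleftrightarrow> (?f A, ?f B) \<in> parcs (AFR l n)"
    if AB: "A \<in> pverts ?R" "B \<in> pverts ?R" for A B
  proof -
    have f: "?f A \<in> pverts (AFR l n)" "?f B \<in> pverts (AFR l n)"
      using AB bij by (auto dest: bij_betwE)
    have "afr_set l n (?f A) = A" "afr_set l n (?f B) = B"
      using AB img by (simp_all add: f_inv_into_f)
    then have "(?f A, ?f B) \<in> parcs (AFR l n) \<longleftrightarrow> reconf_adj (complete_multipartite l n) A B"
      using afr_adj_iff_reconf_adj[OF assms(2) f] f parcs_AFR[of l n] n1 by simp
    then show ?thesis using AB by (simp add: reconf_graph_def)
  qed
  moreover have "pair_wf_digraph ?R"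
    by (intro pair_graph_imp_pair_wf_digraph pair_graph_reconf_graph)
      (simp add: pverts_complete_multipartite)
  moreover have "pair_wf_digraph (AFR l n)"
    using n1 by (intro pair_graph_imp_pair_wf_digraph pair_graph_AFR) blast
  ultimately show ?thesis
    using bij by (subst digraph_iso_with_proj_iff) blast+
qed

end
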